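(* Let $n\ge 1$, $0\le k\le n-1$ and $\pi\in S_n$. The number $del_{k+1}(\pi)$ of occurrences of $s_{k+1}$ in the canonical presentation of $\pi$ equals the number of $k$-th almost left to right minima of $\pi$, i.e. $$del_{k+1}(\pi)=\#\{\, i \mid k+2\le i\le n,\ \#\{j<i\mid \pi(j)<\pi(i)\}\le k\,\}.$$
   Context: Permutations in $S_n$ are multiplied as functions: $(\sigma\tau)(i)=\sigma(\tau(i))$. Let $s_i=(i,i+1)$, $1\le i\le n-1$. Canonical presentation: for $1\le j\le n-1$ let $R_j=\{1,\ s_j,\ s_js_{j-1},\ \ldots,\ s_js_{j-1}\cdots s_1\}$. Every $w\in S_n$ can be written uniquely as $w=w_1w_2\cdots w_{n-1}$ with $w_j\in R_j$; this product, regarded as a word in the $s_i$ (each $w_j$ being spelled as displayed in $R_j$), is the canonical presentation of $w$. $del_q(\pi)$ denotes the number of times $s_q$ appears in the canonical presentation of $\pi$ (it is $0$ if $s_q\notin S_n$). The set of $k$-th almost left to right minima of $\pi\in S_n$ is the set of indices $Del_{k+1}(\pi)=\{ i \mid k+2\le i\le n,\ \#\{j<i\mid \pi(j)<\pi(i)\}\le k\}$. *)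

theory Defs
  imports "HOL-Combinatorics.Permutations"
begin

text \<open>\<open>S\<^sub>n\<close> is the set of functions on \<^typ>\<open>nat\<close> that permute \<open>{1..n}\<close> (and fix
  everything else), with composition as product.  A word in the \<open>s\<^sub>i\<close> is the list of its
  indices.\<close>

definition simple_transp :: "nat \<Rightarrow> nat \<Rightarrow> nat" where
  "simple_transp i = transpose i (i + 1)"

definition word_perm :: "nat list \<Rightarrow> nat \<Rightarrow> nat" where
  "word_perm w = foldr (\<lambda>i \<sigma>. simple_transp i \<circ> \<sigma>) w id"

text \<open>The elements of \<open>R\<^sub>j\<close>, spelled as words: the prefixes of \<open>s\<^sub>j s\<^sub>j\<^sub>-\<^sub>1 \<dots> s\<^sub>1\<close>.\<close>

definition R_words :: "nat \<Rightarrow> nat list set" where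
  "R_words j = {take r (rev [1..<j + 1]) | r. r \<le> j}"

text \<open>Note that \<open>[1..<n]\<close> is the list of the \<open>j\<close> with \<open>1 \<le> j \<le> n - 1\<close>.\<close>

definition is_canonical_presentation :: "nat \<Rightarrow> (nat \<Rightarrow> nat) \<Rightarrow> nat list \<Rightarrow> bool" where
  "is_canonical_presentation n \<pi> w \<longleftrightarrow>
     (\<exists>u. (\<forall>j\<in>{1..<n}. u j \<in> R_words j) \<and> w = concat (map u [1..<n])) \<and> word_perm w = \<pi>"

definition canonical_presentation :: "nat \<Rightarrow> (nat \<Rightarrow> nat) \<Rightarrow> nat list" where
  "canonical_presentation n \<pi> = (THE w. is_canonical_presentation n \<pi> w)"

definition del :: "nat \<Rightarrow> nat \<Rightarrow> (nat \<Rightarrow> nat) \<Rightarrow> nat" where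
  "del n q \<pi> = count_list (canonical_presentation n \<pi>) q"

definition almost_ltr_minima :: "nat \<Rightarrow> nat \<Rightarrow> (nat \<Rightarrow> nat) \<Rightarrow> nat set" where
  "almost_ltr_minima n k \<pi> =
     {i. k + 2 \<le> i \<and> i \<le> n \<and> card {j. 1 \<le> j \<and> j < i \<and> \<pi> j < \<pi> i} \<le> k}"

end

theory Submission
  imports Defs
begin

text \<open>
  The proof is an induction on \<open>n\<close>, peeling off the last factor of the canonical presentation.
  As a permutation, \<open>s\<^sub>n s\<^sub>n\<^sub>-\<^sub>1 \<dots> s\<^sub>m\<close> sends \<open>m\<close> to \<open>n + 1\<close> and shifts \<open>m + 1, \<dots>, n + 1\<close> down by one.
  So if \<open>\<pi> = \<sigma> s\<^sub>n \<dots> s\<^sub>m\<close> with \<open>\<sigma> \<in> S\<^sub>n\<close>, then the one-line notation of \<open>\<pi>\<close> is that of \<open>\<sigma>\<close> with the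
  new largest value \<open>n + 1\<close> inserted at position \<open>m\<close>.  In particular \<open>m\<close> is the position of the
  maximum of \<open>\<pi>\<close>; this determines the last factor, and hence the whole presentation, uniquely
  (\<open>ex1_canonical_presentation\<close>).

  Now compare both sides for \<open>\<pi>\<close> and \<open>\<sigma>\<close>.  The last factor contributes one letter \<open>s\<^sub>k\<^sub>+\<^sub>1\<close> exactly if
  \<open>m \<le> k + 1 \<le> n\<close>.  On the other side, inserting a largest value changes no number of
  smaller predecessors at the old positions, but it moves the positions from \<open>m\<close> on to the
  right by one.  The inserted position \<open>m\<close> itself has \<open>m - 1\<close> smaller predecessors, so it can not
  satisfy both \<open>k + 2 \<le> m\<close> and \<open>m - 1 \<le> k\<close>.  The only position that can newly pass the bound
  \<open>k + 2 \<le> i\<close> is the old position \<open>k + 1\<close>, which happens exactly if \<open>m \<le> k + 1 \<le> n\<close>; as it has only \<open>k\<close>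
  predecessors at all, it is then a new \<open>k\<close>-th almost left to right minimum
  (\<open>card_almost_ltr_minima_insert_max\<close>).
\<close>

section \<open>Words and the permutations they denote\<close>

lemma word_perm_Nil: "word_perm [] = id"
  by (simp add: word_perm_def)

lemma word_perm_Cons: "word_perm (i # w) = simple_transp i \<circ> word_perm w"
  by (simp add: word_perm_def)

lemma word_perm_append: "word_perm (v @ w) = word_perm v \<circ> word_perm w"
  by (induction v) (simp_all add: word_perm_Nil word_perm_Cons comp_assoc)

lemma word_perm_permutes:
  assumes "set w \<subseteq> {1..<n}"
  shows "word_perm w permutes {1..n}"
  using assms
proof (induction w)
  case Nil
  then show ?case by (simp only: word_perm_Nil permutes_id)
next
  case (Cons i w)
  have "simple_transp i permutes {1..n}"
    using Cons.prems unfolding simple_transp_def by (intro permutes_swap_id) auto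
  moreover have "word_perm w permutes {1..n}" using Cons by simp
  ultimately show ?case unfolding word_perm_Cons by (intro permutes_compose)
qed

text \<open>Indexing the elements of \<open>R\<^sub>j\<close> by their last letter \<open>m\<close> instead of their length is convenient
  because \<open>m\<close> will be the position at which a new maximum is inserted; the empty word is the case
  \<open>m = j + 1\<close>.\<close>

lemma R_words_eq: "R_words j = {rev [m..<Suc j] | m. 1 \<le> m \<and> m \<le> Suc j}"
proof -
  have take_eq: "take r (rev [1..<j + 1]) = rev [Suc j - r..<Suc j]" if "r \<le> j" for r
    using that by (simp add: take_rev Suc_diff_le del: upt_Suc)
  show ?thesis
  proof (intro equalityI subsetI)
    fix w assume "w \<in> R_words j"
    then obtain r where r: "r \<le> j" "w = take r (rev [1..<j + 1])"
      by (auto simp: R_words_def)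
    then show "w \<in> {rev [m..<Suc j] | m. 1 \<le> m \<and> m \<le> Suc j}"
      unfolding mem_Collect_eq take_eq[OF r(1)] by (intro exI[of _ "Suc j - r"]) simp
  next
    fix w assume "w \<in> {rev [m..<Suc j] | m. 1 \<le> m \<and> m \<le> Suc j}"
    then obtain m where m: "1 \<le> m" "m \<le> Suc j" "w = rev [m..<Suc j]" by blast
    then have "w = take (Suc j - m) (rev [1..<j + 1])"
      using take_eq[of "Suc j - m"] by simp
    with m show "w \<in> R_words j"
      unfolding R_words_def by (intro CollectI exI[of _ "Suc j - m"]) simp
  qed
qed

lemma word_perm_descending:
  assumes "m \<le> Suc j"
  shows "word_perm (rev [m..<Suc j]) i =
    (if i = m then Suc j else if m < i \<and> i \<le> Suc j then i - 1 else i)"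
  using assms
proof (induction j)
  case 0
  then show ?case
    by (cases "m = 0") (auto simp: word_perm_Nil word_perm_Cons simple_transp_def transpose_def)
next
  case (Suc j)
  show ?case
  proof (cases "m = Suc (Suc j)")
    case True
    then show ?thesis by (auto simp: word_perm_Nil)
  next
    case False
    with Suc.prems have "m \<le> Suc j" by simp
    then have "rev [m..<Suc (Suc j)] = Suc j # rev [m..<Suc j]" by simp
    with Suc.IH \<open>m \<le> Suc j\<close> show ?thesis
      by (auto simp: word_perm_Cons simple_transp_def transpose_def simp del: upt_Suc)
  qed
qed

lemma word_perm_descending_permutes:
  assumes "1 \<le> m"
  shows "word_perm (rev [m..<Suc n]) permutes {1..Suc n}"
  using assms by (intro word_perm_permutes) auto

section \<open>Existence and uniqueness of the canonical presentation\<close>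

lemma is_canonical_presentation_permutes:
  assumes "is_canonical_presentation n \<pi> w"
  shows "\<pi> permutes {1..n}"
proof -
  obtain u where u: "\<forall>j\<in>{1..<n}. u j \<in> R_words j" "w = concat (map u [1..<n])" "word_perm w = \<pi>"
    using assms by (auto simp: is_canonical_presentation_def)
  have "set (u j) \<subseteq> {1..<n}" if "j \<in> {1..<n}" for j
    using u(1) that by (fastforce simp: R_words_eq)
  then have "set w \<subseteq> {1..<n}" using u(2) by fastforce
  then show ?thesis using word_perm_permutes u(3) by blast
qed

lemma is_canonical_presentation_0_iff:
  "is_canonical_presentation 0 \<pi> w \<longleftrightarrow> w = [] \<and> \<pi> = id"
  by (auto simp: is_canonical_presentation_def word_perm_Nil)

text \<open>Splitting off the last factor \<open>w\<^sub>n\<close>.  For \<open>n = 0\<close> there is no such factor, and the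
  equivalence holds with \<open>m = 1\<close>, for which the split off word is empty.\<close>

lemma is_canonical_presentation_Suc_iff:
  "is_canonical_presentation (Suc n) \<pi> w \<longleftrightarrow>
    (\<exists>m \<sigma> v. 1 \<le> m \<and> m \<le> Suc n \<and> is_canonical_presentation n \<sigma> v \<and>
      w = v @ rev [m..<Suc n] \<and> \<pi> = \<sigma> \<circ> word_perm (rev [m..<Suc n]))"
  (is "?L \<longleftrightarrow> ?R")
proof (cases "n = 0")
  case True
  have "?L \<longleftrightarrow> w = [] \<and> \<pi> = id"
    using True by (auto simp: is_canonical_presentation_def word_perm_Nil)
  also have "\<dots> \<longleftrightarrow> ?R"
  proof
    assume "w = [] \<and> \<pi> = id"
    then show ?R
      using True by (intro exI[of _ 1] exI[of _ id] exI[of _ "[]"])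
        (simp add: is_canonical_presentation_0_iff word_perm_Nil)
  next
    assume ?R
    then obtain m \<sigma> v where m: "1 \<le> m" "m \<le> Suc n"
      and "is_canonical_presentation n \<sigma> v" "w = v @ rev [m..<Suc n]"
        "\<pi> = \<sigma> \<circ> word_perm (rev [m..<Suc n])" by blast
    moreover have "[m..<Suc n] = []" using m True by simp
    ultimately show "w = [] \<and> \<pi> = id"
      using True by (simp add: is_canonical_presentation_0_iff word_perm_Nil)
  qed
  finally show ?thesis .
next
  case False
  show ?thesis
  proof
    assume ?L
    then obtain u where u: "\<forall>j\<in>{1..<Suc n}. u j \<in> R_words j"
      "w = concat (map u [1..<Suc n])" "word_perm w = \<pi>"
      by (auto simp: is_canonical_presentation_def)
    let ?v = "concat (map u [1..<n])"
    from u(1) False have "u n \<in> R_words n" by simp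
    then obtain m where m: "1 \<le> m" "m \<le> Suc n" "u n = rev [m..<Suc n]"
      unfolding R_words_eq by blast
    have w: "w = ?v @ rev [m..<Suc n]" using u(2) m(3) False by simp
    have "is_canonical_presentation n (word_perm ?v) ?v"
      using u(1) unfolding is_canonical_presentation_def by (intro conjI exI[of _ u]) auto
    with m w u(3) show ?R by (metis word_perm_append)
  next
    assume ?R
    then obtain m \<sigma> v where m: "1 \<le> m" "m \<le> Suc n"
      and \<sigma>: "is_canonical_presentation n \<sigma> v"
      and w: "w = v @ rev [m..<Suc n]" and \<pi>: "\<pi> = \<sigma> \<circ> word_perm (rev [m..<Suc n])" by blast
    obtain u where u: "\<forall>j\<in>{1..<n}. u j \<in> R_words j" "v = concat (map u [1..<n])"
      "word_perm v = \<sigma>"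
      using \<sigma> by (auto simp: is_canonical_presentation_def)
    let ?u = "u(n := rev [m..<Suc n])"
    have "\<forall>j\<in>{1..<Suc n}. ?u j \<in> R_words j"
      using u(1) m by (auto simp: R_words_eq less_Suc_eq simp del: upt_Suc)
    moreover have "w = concat (map ?u [1..<Suc n])"
    proof -
      have "map ?u [1..<n] = map u [1..<n]" by simp
      moreover have "[1..<Suc n] = [1..<n] @ [n]" using False by simp
      ultimately show ?thesis using w u(2) by (simp del: upt_Suc)
    qed
    moreover have "word_perm w = \<pi>" using w \<pi> u(3) by (simp add: word_perm_append)
    ultimately show ?L unfolding is_canonical_presentation_def by blast
  qed
qed

lemma ex1_canonical_presentation:
  assumes "\<pi> permutes {1..n}"
  shows "\<exists>!w. is_canonical_presentation n \<pi> w"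
  using assms
proof (induction n arbitrary: \<pi>)
  case 0
  then have "\<pi> = id" by simp
  then show ?case unfolding is_canonical_presentation_0_iff by blast
next
  case (Suc n)
  define m where "m = inv \<pi> (Suc n)"
  define c where "c = word_perm (rev [m..<Suc n])"
  define \<sigma> where "\<sigma> = \<pi> \<circ> inv c"
  have \<pi>m: "\<pi> m = Suc n"
    unfolding m_def using Suc.prems by (simp add: permutes_inverses)
  have "m \<in> {1..Suc n}"
    unfolding m_def using permutes_in_image[OF permutes_inv[OF Suc.prems]] by simp
  then have m: "1 \<le> m" "m \<le> Suc n" by auto
  have c: "c permutes {1..Suc n}"
    unfolding c_def using m(1) by (rule word_perm_descending_permutes)
  have "c m = Suc n" unfolding c_def by (subst word_perm_descending[OF m(2)]) simp
  then have "inv c (Suc n) = m" using c by (metis permutes_inverses(2))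
  then have "\<sigma> (Suc n) = Suc n" using \<pi>m by (simp add: \<sigma>_def)
  moreover have "\<sigma> permutes {1..Suc n}"
    unfolding \<sigma>_def by (intro permutes_compose permutes_inv c Suc.prems)
  ultimately have "\<sigma> permutes {1..n}"
    by (metis DiffE atLeastAtMost_iff le_Suc_eq permutes_superset)
  then obtain v where v: "is_canonical_presentation n \<sigma> v"
    and v_unique: "\<And>v'. is_canonical_presentation n \<sigma> v' \<Longrightarrow> v' = v"
    using Suc.IH by blast
  have "\<pi> = \<sigma> \<circ> c"
    using c by (simp add: \<sigma>_def comp_assoc permutes_inv_o)
  show ?case
  proof (rule ex1I)
    show "is_canonical_presentation (Suc n) \<pi> (v @ rev [m..<Suc n])"
      unfolding is_canonical_presentation_Suc_iff
      using m v \<open>\<pi> = \<sigma> \<circ> c\<close> unfolding c_def by blast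
  next
    fix w assume "is_canonical_presentation (Suc n) \<pi> w"
    then obtain m' \<sigma>' v' where m': "1 \<le> m'" "m' \<le> Suc n"
      and v': "is_canonical_presentation n \<sigma>' v'"
      and w: "w = v' @ rev [m'..<Suc n]" and \<pi>': "\<pi> = \<sigma>' \<circ> word_perm (rev [m'..<Suc n])"
      unfolding is_canonical_presentation_Suc_iff by blast
    \<comment> \<open>Both \<open>m\<close> and \<open>m'\<close> are the position of the maximum of \<open>\<pi>\<close>.\<close>
    have "\<sigma>' (Suc n) = Suc n"
      using is_canonical_presentation_permutes[OF v'] by (auto intro: permutes_not_in)
    then have "\<pi> m' = Suc n"
      unfolding \<pi>' using word_perm_descending[OF m'(2), of m'] by simp
    then have "m' = m"
      using \<pi>m permutes_inj[OF Suc.prems] by (metis injD)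
    then have "\<pi> = \<sigma>' \<circ> c" using \<pi>' by (simp add: c_def)
    then have "\<sigma>' = \<sigma>"
      using c by (simp add: \<sigma>_def comp_assoc permutes_inv_o)
    then show "w = v @ rev [m..<Suc n]"
      using w v' v_unique \<open>m' = m\<close> by simp
  qed
qed

section \<open>Inserting a new maximum\<close>

lemma count_list_descending:
  assumes "m \<le> Suc n"
  shows "count_list (rev [m..<Suc n]) q = (if m \<le> q \<and> q \<le> n then 1 else 0)"
  using assms by (induction n) (auto simp: le_Suc_eq)

text \<open>The increasing map \<open>d\<close> in the proof sends the positions of \<open>\<sigma>\<close> to the positions that the same
  entries have in \<open>\<pi>\<close>.  Along \<open>d\<close>, the almost left to right minima of \<open>\<pi>\<close> correspond to those of \<open>\<sigma>\<close>,
  with the additional position \<open>k + 1\<close> if it is moved past the bound.\<close>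

lemma card_almost_ltr_minima_insert_max:
  assumes m: "1 \<le> m" "m \<le> Suc n"
    and \<sigma>: "\<sigma> permutes {1..n}"
    and \<pi>: "\<pi> = \<sigma> \<circ> word_perm (rev [m..<Suc n])"
  shows "card (almost_ltr_minima (Suc n) k \<pi>) =
    card (almost_ltr_minima n k \<sigma>) + (if m \<le> k + 1 \<and> k + 1 \<le> n then 1 else 0)"
proof -
  define d where "d i = (if i < m then i else Suc i)" for i
  define smaller where "smaller \<rho> i = {j. 1 \<le> j \<and> j < i \<and> \<rho> j < \<rho> i}" for \<rho> :: "nat \<Rightarrow> nat" and i
  have minima_iff: "i \<in> almost_ltr_minima N k \<rho> \<longleftrightarrow> k + 2 \<le> i \<and> i \<le> N \<and> card (smaller \<rho> i) \<le> k"
    for \<rho> N i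
    by (simp add: almost_ltr_minima_def smaller_def)
  have d_less_iff: "d i < d j \<longleftrightarrow> i < j" for i j by (auto simp: d_def)
  have inj_d: "inj d" by (rule injI) (auto simp: d_def split: if_splits)
  have \<pi>m: "\<pi> m = Suc n"
    using permutes_not_in[OF \<sigma>, of "Suc n"] m by (simp add: \<pi> word_perm_descending del: upt_Suc)
  have \<pi>d: "\<pi> (d i) = \<sigma> i" if "i \<le> n" for i
    using m that by (auto simp: \<pi> d_def word_perm_descending simp del: upt_Suc)
  have \<sigma>_le: "\<sigma> i \<le> n" if "1 \<le> i" "i \<le> n" for i
    using permutes_in_image[OF \<sigma>, of i] that by simp
  have range_d: "\<exists>i'. i = d i' \<and> 1 \<le> i' \<and> i' \<le> n" if "1 \<le> i" "i \<le> Suc n" "i \<noteq> m" for i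
    using that m by (intro exI[of _ "if i < m then i else i - 1"]) (auto simp: d_def)

  have smaller_d: "smaller \<pi> (d i) = d ` smaller \<sigma> i" if i: "1 \<le> i" "i \<le> n" for i
  proof (intro equalityI subsetI)
    fix j assume j: "j \<in> smaller \<pi> (d i)"
    \<comment> \<open>The inserted value is the largest, so \<open>m\<close> is not among the smaller predecessors.\<close>
    have "j \<noteq> m" using j \<pi>d[OF i(2)] \<pi>m \<sigma>_le[OF i] by (auto simp: smaller_def)
    moreover have "1 \<le> j" "j \<le> Suc n" using j i by (auto simp: smaller_def d_def split: if_splits)
    ultimately obtain j' where j': "j = d j'" "1 \<le> j'" "j' \<le> n" using range_d by blast
    then have "j' \<in> smaller \<sigma> i" using j i by (auto simp: smaller_def d_less_iff \<pi>d)
    with j' show "j \<in> d ` smaller \<sigma> i" by blast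
  next
    fix j assume "j \<in> d ` smaller \<sigma> i"
    then obtain j' where j': "j = d j'" "j' \<in> smaller \<sigma> i" by blast
    then have "1 \<le> j" by (auto simp: smaller_def d_def)
    with j' i show "j \<in> smaller \<pi> (d i)" by (auto simp: smaller_def d_less_iff \<pi>d)
  qed
  have card_smaller_d: "card (smaller \<pi> (d i)) = card (smaller \<sigma> i)" if "1 \<le> i" "i \<le> n" for i
    using smaller_d[OF that] card_image[OF inj_on_subset[OF inj_d subset_UNIV]] by simp

  have "smaller \<pi> m = {1..<m}"
  proof -
    have "\<pi> j < Suc n" if "1 \<le> j" "j < m" for j
      using \<pi>d[of j] \<sigma>_le[of j] that m by (simp add: d_def)
    then show ?thesis by (auto simp: smaller_def \<pi>m)
  qed
  then have m_not_minimum: "m \<notin> almost_ltr_minima (Suc n) k \<pi>"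
    using m(1) by (auto simp: minima_iff)

  let ?A = "{i. 1 \<le> i \<and> i \<le> n \<and> k + 2 \<le> d i \<and> card (smaller \<sigma> i) \<le> k}"
  have "almost_ltr_minima (Suc n) k \<pi> = d ` ?A"
  proof (intro equalityI subsetI)
    fix i assume i: "i \<in> almost_ltr_minima (Suc n) k \<pi>"
    then have "1 \<le> i" "i \<le> Suc n" "i \<noteq> m"
      using m_not_minimum by (auto simp: minima_iff)
    then obtain i' where i': "i = d i'" "1 \<le> i'" "i' \<le> n" using range_d by blast
    with i have "i' \<in> ?A"
      using card_smaller_d[of i'] by (auto simp: minima_iff)
    with i' show "i \<in> d ` ?A" by blast
  next
    fix i assume "i \<in> d ` ?A"
    then obtain i' where i': "i = d i'" "i' \<in> ?A" by blast
    then have "i \<le> Suc n" by (auto simp: d_def)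
    with i' show "i \<in> almost_ltr_minima (Suc n) k \<pi>"
      using card_smaller_d[of i'] by (auto simp: minima_iff)
  qed
  then have card_\<pi>: "card (almost_ltr_minima (Suc n) k \<pi>) = card ?A"
    using card_image[OF inj_on_subset[OF inj_d subset_UNIV]] by simp

  have card_smaller_le: "card (smaller \<sigma> (k + 1)) \<le> k"
  proof -
    have "smaller \<sigma> (k + 1) \<subseteq> {1..k}" by (auto simp: smaller_def)
    then show ?thesis using card_mono[of "{1..k}"] by fastforce
  qed
  have \<sigma>_minima: "almost_ltr_minima n k \<sigma> = {i. k + 2 \<le> i \<and> i \<le> n \<and> card (smaller \<sigma> i) \<le> k}"
    by (auto simp: minima_iff)
  have shifted: "k + 2 \<le> d i \<longleftrightarrow> k + 2 \<le> i \<or> (i = k + 1 \<and> m \<le> k + 1)" for i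
    by (auto simp: d_def)
  have "?A = almost_ltr_minima n k \<sigma> \<union> (if m \<le> k + 1 \<and> k + 1 \<le> n then {k + 1} else {})"
    unfolding \<sigma>_minima shifted using card_smaller_le by auto
  moreover have "finite (almost_ltr_minima n k \<sigma>)" by (simp add: \<sigma>_minima)
  moreover have "k + 1 \<notin> almost_ltr_minima n k \<sigma>" by (simp add: \<sigma>_minima)
  ultimately show ?thesis using card_\<pi> by simp
qed

section \<open>Counting letters of the canonical presentation\<close>

lemma count_list_canonical_presentation:
  assumes "is_canonical_presentation n \<pi> w"
  shows "count_list w (k + 1) = card (almost_ltr_minima n k \<pi>)"
  using assms
proof (induction n arbitrary: \<pi> w)
  case 0
  then show ?case by (auto simp: is_canonical_presentation_0_iff almost_ltr_minima_def)
next
  case (Suc n)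
  then obtain m \<sigma> v where m: "1 \<le> m" "m \<le> Suc n"
    and v: "is_canonical_presentation n \<sigma> v"
    and w: "w = v @ rev [m..<Suc n]" and \<pi>: "\<pi> = \<sigma> \<circ> word_perm (rev [m..<Suc n])"
    unfolding is_canonical_presentation_Suc_iff by blast
  have "count_list w (k + 1) = card (almost_ltr_minima n k \<sigma>)
      + (if m \<le> k + 1 \<and> k + 1 \<le> n then 1 else 0)"
    unfolding w count_list_append count_list_descending[OF m(2)] Suc.IH[OF v] ..
  also have "\<dots> = card (almost_ltr_minima (Suc n) k \<pi>)"
    using card_almost_ltr_minima_insert_max[OF m is_canonical_presentation_permutes[OF v] \<pi>] by simp
  finally show ?case .
qed

theorem proposition2p3:
  fixes n k :: nat and \<pi> :: "nat \<Rightarrow> nat"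
  assumes "n \<ge> 1" and "k \<le> n - 1" and "\<pi> permutes {1..n}"
  shows "del n (k + 1) \<pi> = card (almost_ltr_minima n k \<pi>)"
proof -
  have "is_canonical_presentation n \<pi> (canonical_presentation n \<pi>)"
    unfolding canonical_presentation_def
    by (rule theI') (rule ex1_canonical_presentation[OF assms(3)])
  then show ?thesis
    unfolding del_def by (rule count_list_canonical_presentation)
qed

end
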